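(* Let $E_1$ and $E_2$ be complex normed spaces and let $J:E_1\to E_2$ be a function with $J(0)=0$. Then the following two conditions are equivalent: (1) $\left\|2J\!\left(\frac{x+y}{2}\right)-J(x)-J(y)\right\|\to0$ as $\|x\|+\|y\|\to\infty$; (2) $2J\!\left(\frac{x+y}{2}\right)-J(x)-J(y)=0$ for all $x,y\in E_1$.
   Context: Condition (1) means: for every $\varepsilon>0$ there is $M>0$ such that $\|2J(\frac{x+y}{2})-J(x)-J(y)\|<\varepsilon$ for all $x,y\in E_1$ with $\|x\|+\|y\|>M$. The space $E_2$ is not assumed complete. *)

theory Defs
  imports Complex_Main
begin

text \<open>
  A complex normed space is a real normed space together with a complex scalar multiplication
  that extends the real one and for which the norm is absolutely homogeneous. Starting from
  \<^class>\<open>real_normed_vector\<close> costs no generality, since every complex normed space is a real one by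
  restriction of scalars, and makes the usual norm and metric notions available.
  No completeness is required.
\<close>

class complex_normed_vector = real_normed_vector +
  fixes scaleC :: "complex \<Rightarrow> 'a \<Rightarrow> 'a" (infixr "*\<^sub>C" 75)
  assumes scaleC_add_right: "a *\<^sub>C (x + y) = a *\<^sub>C x + a *\<^sub>C y"
    and scaleC_add_left: "(a + b) *\<^sub>C x = a *\<^sub>C x + b *\<^sub>C x"
    and scaleC_scaleC: "a *\<^sub>C b *\<^sub>C x = (a * b) *\<^sub>C x"
    and scaleC_one: "1 *\<^sub>C x = x"
    and scaleR_scaleC: "r *\<^sub>R x = complex_of_real r *\<^sub>C x"
    and norm_scaleC: "norm (a *\<^sub>C x) = cmod a * norm x"

instantiation complex :: complex_normed_vector
begin

definition scaleC_complex :: "complex \<Rightarrow> complex \<Rightarrow> complex"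
  where "scaleC_complex a x = a * x"

instance
  by standard
    (simp_all add: scaleC_complex_def algebra_simps scaleR_conv_of_real norm_mult)

end

end

theory Submission
  imports Defs
begin

text \<open>
  Let \<open>F(x, y) = 2 J((x + y)/2) - J x - J y\<close> denote the Jensen defect. For every \<open>z\<close>,
  \<open>2 F(x, y) = F(x + z, y - z) + F(x - z, y + z) - F(x + z, x - z) - F(y + z, y - z)\<close>,
  because the midpoints on the right-hand side do not depend on \<open>z\<close> and the remaining values of
  \<open>J\<close> cancel. As \<open>z\<close> tends to infinity, so do all four pairs of arguments on the right.
\<close>

definition jensen_defect :: "('a::real_vector \<Rightarrow> 'b::real_vector) \<Rightarrow> 'a \<Rightarrow> 'a \<Rightarrow> 'b"
  where "jensen_defect f x y = 2 *\<^sub>R f ((1/2) *\<^sub>R (x + y)) - f x - f y"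

lemma jensen_defect_shift:
  "2 *\<^sub>R jensen_defect f x y =
     jensen_defect f (x + z) (y - z) + jensen_defect f (x - z) (y + z)
     - jensen_defect f (x + z) (x - z) - jensen_defect f (y + z) (y - z)"
proof -
  \<comment> \<open>The pairs \<open>(x + z, x - z)\<close> and \<open>(y + z, y - z)\<close> have
    midpoints \<open>x\<close> and \<open>y\<close>; they supply the multiples of \<open>f x\<close>
    and \<open>f y\<close> on the left.\<close>
  have "(1/2) *\<^sub>R (u + u) = u" for u :: 'a
    by (metis scaleR_half_double)
  then show ?thesis
    unfolding jensen_defect_def by (simp add: algebra_simps flip: scaleR_2)
qed

lemma ex_norm_gt:
  fixes v :: "'a::real_normed_vector"
  assumes "v \<noteq> 0"
  shows "\<exists>z::'a. norm z > r"
proof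
  show "norm (((\<bar>r\<bar> + 1) / norm v) *\<^sub>R v) > r"
    using assms by simp
qed

text \<open>A nonzero \<open>v\<close> excludes the zero space, where no \<open>z\<close> can tend
  to infinity.\<close>

lemma jensen_defect_eq_0_if_vanishing_at_infinity:
  fixes f :: "'a::real_normed_vector \<Rightarrow> 'b::real_normed_vector"
  assumes vanishing: "\<And>\<epsilon>::real. \<epsilon> > 0 \<Longrightarrow>
      \<exists>M. \<forall>x y. norm x + norm y > M \<longrightarrow> norm (jensen_defect f x y) < \<epsilon>"
    and nontrivial: "v \<noteq> (0::'a)"
  shows "jensen_defect f x y = 0"
proof -
  have "norm (jensen_defect f x y) \<le> 0 + e" if "e > 0" for e
  proof -
    \<comment> \<open>Four terms below \<open>e / 2\<close> sum to less than \<open>2 * e\<close>,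
      which matches the factor 2 on the left of the shift identity.\<close>
    have "e / 2 > 0" using that by simp
    with vanishing obtain M where
      M: "\<And>x y. norm x + norm y > M \<Longrightarrow> norm (jensen_defect f x y) < e / 2"
      by blast
    \<comment> \<open>By the reverse triangle inequality, this \<open>z\<close> pushes each of
      \<open>x + z\<close>, \<open>x - z\<close>, \<open>y + z\<close>, \<open>y - z\<close> beyond
      \<open>\<bar>M\<bar>\<close>, so every pair of them is in the range of
      \<open>M\<close>.\<close>
    obtain z :: 'a where z: "norm z > \<bar>M\<bar> + norm x + norm y"
      using ex_norm_gt[OF nontrivial] by blast
    have far: "norm (a + z) > \<bar>M\<bar>" "norm (a - z) > \<bar>M\<bar>" if "a \<in> {x, y}" for a
    proof -
      have "norm a \<le> norm x + norm y"
        using that by auto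
      with z have "norm z - norm a > \<bar>M\<bar>"
        by linarith
      then show "norm (a + z) > \<bar>M\<bar>" "norm (a - z) > \<bar>M\<bar>"
        using norm_diff_ineq[of z a] norm_triangle_ineq2[of z a]
        by (simp_all add: add.commute norm_minus_commute)
    qed
    let ?A = "jensen_defect f (x + z) (y - z)"
    let ?B = "jensen_defect f (x - z) (y + z)"
    let ?C = "jensen_defect f (x + z) (x - z)"
    let ?D = "jensen_defect f (y + z) (y - z)"
    have small: "norm ?A < e / 2" "norm ?B < e / 2" "norm ?C < e / 2" "norm ?D < e / 2"
      by (rule M; use far[of x] far[of y] in simp)+
    have "2 * norm (jensen_defect f x y) = norm (?A + ?B - ?C - ?D)"
      by (simp flip: jensen_defect_shift)
    also have "\<dots> \<le> norm ?A + norm ?B + norm ?C + norm ?D"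
      using norm_triangle_ineq[of ?A ?B] norm_triangle_ineq4[of "?A + ?B" ?C]
        norm_triangle_ineq4[of "?A + ?B - ?C" ?D]
      by linarith
    finally show ?thesis using small by linarith
  qed
  then have "norm (jensen_defect f x y) \<le> 0"
    by (rule field_le_epsilon)
  then show ?thesis by simp
qed

text \<open>The scalars 2 and 1/2 are real, so the problem reduces to real normed spaces.\<close>

lemma jensen_defect_scaleC:
  fixes f :: "'a::complex_normed_vector \<Rightarrow> 'b::complex_normed_vector"
  shows "2 *\<^sub>C f ((1/2) *\<^sub>C (x + y)) - f x - f y = jensen_defect f x y"
  by (simp add: jensen_defect_def scaleR_scaleC)

theorem theorem4p7:
  fixes J :: "'a::complex_normed_vector \<Rightarrow> 'b::complex_normed_vector"
  assumes "J 0 = 0"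
  shows "(\<forall>\<epsilon>>0::real. \<exists>M>0::real. \<forall>x y. norm x + norm y > M \<longrightarrow>
            norm (2 *\<^sub>C J ((1/2) *\<^sub>C (x + y)) - J x - J y) < \<epsilon>)
     \<longleftrightarrow> (\<forall>x y. 2 *\<^sub>C J ((1/2) *\<^sub>C (x + y)) - J x - J y = 0)"
  unfolding jensen_defect_scaleC
proof (intro iffI allI)
  fix x y :: 'a
  assume *: "\<forall>\<epsilon>>0::real. \<exists>M>0::real. \<forall>x y. norm x + norm y > M \<longrightarrow> norm (jensen_defect J x y) < \<epsilon>"
  show "jensen_defect J x y = 0"
  \<comment> \<open>Outside the origin, \<open>x\<close> or \<open>y\<close> itself is the nonzero
    vector required.\<close>
  proof (cases "x = 0 \<and> y = 0")
    case True
    then show ?thesis using assms by (simp add: jensen_defect_def)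
  next
    case False
    then obtain v :: 'a where "v \<noteq> 0" by blast
    show ?thesis
      by (rule jensen_defect_eq_0_if_vanishing_at_infinity[OF _ \<open>v \<noteq> 0\<close>]) (use * in blast)
  qed
next
  assume "\<forall>x y. jensen_defect J x y = 0"
  then show "\<epsilon> > 0 \<longrightarrow> (\<exists>M>0::real. \<forall>x y. norm x + norm y > M \<longrightarrow> norm (jensen_defect J x y) < \<epsilon>)"
    for \<epsilon> :: real
    by (auto intro: exI[of _ 1])
qed

end
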